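(* The class of UFSS groups has the following permanence properties: (a) If $G$ is UFSS, then its Raikov completion $\widetilde G$ (in which $G$ is a dense subgroup) is UFSS. (b) Every subgroup of a UFSS group is UFSS. (c) Every finite product of UFSS groups is UFSS. (d) Every group locally isomorphic to a UFSS group is UFSS. (e) If an abelian topological group $G$ has a closed subgroup $H$ such that both $H$ and $G/H$ are UFSS, then $G$ is UFSS as well.
   Context: Groups are written additively but are not necessarily abelian unless stated; $0$ is the neutral element; subgroups, quotients and products carry the usual topologies. Neighborhoods are not necessarily open. For a symmetric subset $U\ni 0$ of a group and $n\in\mathbb N=\{1,2,\dots\}$ put $(1/n)U=\{x: kx\in U\ \text{for all } k\in\{1,\dots,n\}\}$. A Hausdorff topological group is UFSS (uniformly free from small subgroups) if for some neighborhood $U$ of $0$ (which may be taken symmetric) the sets $(1/n)U$, $n\in\mathbb N$, form a neighborhood basis at $0$. Two topological groups are locally isomorphic if there is a homeomorphism $f$ between neighborhoods of their neutral elements such that, for $x,y$ in the domain, if $x+y$ lies in the domain then $f(x+y)=f(x)+f(y)$, and likewise for $f^{-1}$. *)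

theory Defs
  imports "HOL-Analysis.Analysis" "HOL-Algebra.Algebra"
begin

text \<open>Groups are groups in the sense of HOL-Algebra, hence written multiplicatively: the neutral
  element \<open>0\<close> is \<open>\<one>\<close>, and \<open>kx\<close> is \<open>x [^] k\<close>. A topological group is not assumed Hausdorff.\<close>

locale topological_group = group G for G (structure) +
  fixes T :: "'a topology"
  assumes topspace_eq_carrier: "topspace T = carrier G"
    and continuous_mult: "continuous_map (prod_topology T T) T (\<lambda>(x, y). x \<otimes> y)"
    and continuous_inv: "continuous_map T T (\<lambda>x. inv x)"

text \<open>Neighbourhoods need not be open.\<close>

definition nbhd :: "'a topology \<Rightarrow> 'a \<Rightarrow> 'a set \<Rightarrow> bool" where
  "nbhd T x U \<longleftrightarrow> U \<subseteq> topspace T \<and> (\<exists>V. openin T V \<and> x \<in> V \<and> V \<subseteq> U)"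

definition nbhd_basis :: "'a topology \<Rightarrow> 'a \<Rightarrow> 'a set set \<Rightarrow> bool" where
  "nbhd_basis T x \<B> \<longleftrightarrow> (\<forall>B\<in>\<B>. nbhd T x B) \<and> (\<forall>W. nbhd T x W \<longrightarrow> (\<exists>B\<in>\<B>. B \<subseteq> W))"

definition symmetric_in :: "('a, 'm) monoid_scheme \<Rightarrow> 'a set \<Rightarrow> bool" where
  "symmetric_in G U \<longleftrightarrow> U \<subseteq> carrier G \<and> (\<forall>x\<in>U. inv\<^bsub>G\<^esub> x \<in> U)"

text \<open>The set \<open>(1/n)U\<close>.\<close>

definition frac_set :: "('a, 'm) monoid_scheme \<Rightarrow> nat \<Rightarrow> 'a set \<Rightarrow> 'a set" where
  "frac_set G n U = {x \<in> carrier G. \<forall>k\<in>{1..n}. x [^]\<^bsub>G\<^esub> k \<in> U}"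

definition UFSS :: "('a, 'm) monoid_scheme \<Rightarrow> 'a topology \<Rightarrow> bool" where
  "UFSS G T \<longleftrightarrow> topological_group G T \<and> Hausdorff_space T \<and>
     (\<exists>U. nbhd T \<one>\<^bsub>G\<^esub> U \<and> symmetric_in G U \<and>
          nbhd_basis T \<one>\<^bsub>G\<^esub> {frac_set G n U | n. n \<ge> 1})"

text \<open>Raikov completeness is completeness in the two-sided group uniformity, whose basic entourages
  are the sets of pairs \<open>(x, y)\<close> with both \<open>x\<inverse>y\<close> and \<open>xy\<inverse>\<close> in a given
  neighbourhood of the neutral element.\<close>

definition two_sided_cauchy :: "('a, 'm) monoid_scheme \<Rightarrow> 'a topology \<Rightarrow> 'a filter \<Rightarrow> bool" where
  "two_sided_cauchy G T F \<longleftrightarrow>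
     F \<noteq> bot \<and> eventually (\<lambda>x. x \<in> carrier G) F \<and>
     (\<forall>U. nbhd T \<one>\<^bsub>G\<^esub> U \<longrightarrow>
        (\<exists>A \<subseteq> carrier G. eventually (\<lambda>x. x \<in> A) F \<and>
           (\<forall>x\<in>A. \<forall>y\<in>A. inv\<^bsub>G\<^esub> x \<otimes>\<^bsub>G\<^esub> y \<in> U \<and> x \<otimes>\<^bsub>G\<^esub> inv\<^bsub>G\<^esub> y \<in> U)))"

definition raikov_complete :: "('a, 'm) monoid_scheme \<Rightarrow> 'a topology \<Rightarrow> bool" where
  "raikov_complete G T \<longleftrightarrow>
     (\<forall>F. two_sided_cauchy G T F \<longrightarrow> (\<exists>l. limitin T (\<lambda>x. x) l F))"

text \<open>The completion is only determined up to a topological isomorphism fixing \<open>G\<close>; the predicate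
  says that \<open>(K, S)\<close> is one, the embedding of \<open>G\<close> as a dense subgroup being \<open>\<iota>\<close>.\<close>

definition raikov_completion ::
  "('a, 'm) monoid_scheme \<Rightarrow> 'a topology \<Rightarrow> ('b, 'n) monoid_scheme \<Rightarrow> 'b topology \<Rightarrow> ('a \<Rightarrow> 'b) \<Rightarrow> bool" where
  "raikov_completion G T K S \<iota> \<longleftrightarrow>
     topological_group K S \<and> Hausdorff_space S \<and> raikov_complete K S \<and>
     \<iota> \<in> hom G K \<and> embedding_map T S \<iota> \<and> S closure_of (\<iota> ` carrier G) = carrier K"

definition locally_isomorphic ::
  "('a, 'm) monoid_scheme \<Rightarrow> 'a topology \<Rightarrow> ('b, 'n) monoid_scheme \<Rightarrow> 'b topology \<Rightarrow> bool" where
  "locally_isomorphic G T K S \<longleftrightarrow>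
     (\<exists>U V f g. nbhd T \<one>\<^bsub>G\<^esub> U \<and> nbhd S \<one>\<^bsub>K\<^esub> V \<and>
        homeomorphic_maps (subtopology T U) (subtopology S V) f g \<and>
        (\<forall>x\<in>U. \<forall>y\<in>U. x \<otimes>\<^bsub>G\<^esub> y \<in> U \<longrightarrow> f (x \<otimes>\<^bsub>G\<^esub> y) = f x \<otimes>\<^bsub>K\<^esub> f y) \<and>
        (\<forall>x\<in>V. \<forall>y\<in>V. x \<otimes>\<^bsub>K\<^esub> y \<in> V \<longrightarrow> g (x \<otimes>\<^bsub>K\<^esub> y) = g x \<otimes>\<^bsub>G\<^esub> g y))"

definition quotient_group_topology ::
  "('a, 'm) monoid_scheme \<Rightarrow> 'a topology \<Rightarrow> 'a set \<Rightarrow> 'a set topology" where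
  "quotient_group_topology G T H =
     topology (\<lambda>\<U>. \<U> \<subseteq> rcosets\<^bsub>G\<^esub> H \<and> openin T {x \<in> topspace T. H #>\<^bsub>G\<^esub> x \<in> \<U>})"

lemma openin_quotient_group_topology:
  "openin (quotient_group_topology G T H) \<U> \<longleftrightarrow>
     \<U> \<subseteq> rcosets\<^bsub>G\<^esub> H \<and> openin T {x \<in> topspace T. H #>\<^bsub>G\<^esub> x \<in> \<U>}"
proof -
  let ?P = "\<lambda>\<U>. \<U> \<subseteq> rcosets\<^bsub>G\<^esub> H \<and> openin T {x \<in> topspace T. H #>\<^bsub>G\<^esub> x \<in> \<U>}"
  have "istopology ?P"
    unfolding istopology_def
  proof (intro conjI allI impI)
    fix A B assume "?P A" "?P B"
    moreover have "{x \<in> topspace T. H #>\<^bsub>G\<^esub> x \<in> A \<inter> B} =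
        {x \<in> topspace T. H #>\<^bsub>G\<^esub> x \<in> A} \<inter> {x \<in> topspace T. H #>\<^bsub>G\<^esub> x \<in> B}"
      by auto
    ultimately show "A \<inter> B \<subseteq> rcosets\<^bsub>G\<^esub> H" 
      and "openin T {x \<in> topspace T. H #>\<^bsub>G\<^esub> x \<in> A \<inter> B}"
      by auto
  next
    fix \<K> assume K: "\<forall>A\<in>\<K>. ?P A"
    have "{x \<in> topspace T. H #>\<^bsub>G\<^esub> x \<in> \<Union>\<K>} = (\<Union>A\<in>\<K>. {x \<in> topspace T. H #>\<^bsub>G\<^esub> x \<in> A})"
      by auto
    moreover have "openin T (\<Union>A\<in>\<K>. {x \<in> topspace T. H #>\<^bsub>G\<^esub> x \<in> A})"
      using K by (intro openin_Union) auto
    ultimately show "openin T {x \<in> topspace T. H #>\<^bsub>G\<^esub> x \<in> \<Union>\<K>}"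
      by simp
    show "\<Union>\<K> \<subseteq> rcosets\<^bsub>G\<^esub> H" using K by blast
  qed
  then show ?thesis
    by (simp add: quotient_group_topology_def topology_inverse')
qed

lemma quotient_map_quotient_group_topology:
  assumes "topspace T = carrier G"
  shows "quotient_map T (quotient_group_topology G T H) (\<lambda>x. H #>\<^bsub>G\<^esub> x)"
proof -
  have img: "(\<lambda>x. H #>\<^bsub>G\<^esub> x) ` topspace T = rcosets\<^bsub>G\<^esub> H"
    using assms by (auto simp: RCOSETS_def)
  then have "{x \<in> topspace T. H #>\<^bsub>G\<^esub> x \<in> rcosets\<^bsub>G\<^esub> H} = topspace T"
    by auto
  then have "openin (quotient_group_topology G T H) (rcosets\<^bsub>G\<^esub> H)"
    by (simp add: openin_quotient_group_topology)
  then have "topspace (quotient_group_topology G T H) = rcosets\<^bsub>G\<^esub> H"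
    by (meson openin_quotient_group_topology openin_subset openin_topspace subset_antisym)
  then show ?thesis
    using img by (auto simp: quotient_map_def openin_quotient_group_topology)
qed

end

theory Submission
  imports Defs
begin

text \<open>Since \<open>(1/n)U\<close> is always a neighbourhood and shrinks with \<open>U\<close>, a Hausdorff group is UFSS as soon as
  some neighbourhood \<open>U\<close>, symmetric or not, has the property that every neighbourhood \<open>W\<close> contains
  some \<open>(1/n)U\<close>. Subgroups and finite products inherit such a \<open>U\<close> by restriction and as a box; a
  local isomorphism \<open>f\<close> satisfies \<open>f(kx) = k f(x)\<close> as long as the multiples of \<open>x\<close> stay in its
  domain, hence pulls \<open>U\<close> back. In a group containing \<open>G\<close> densely, the set \<open>(1/n)V\<close> is open for
  open \<open>V\<close>, so it lies in the closure of its trace on \<open>G\<close>. For the extension, let \<open>x\<close> belong to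
  \<open>(1/m)U\<close> with \<open>m\<close> large: the quotient yields \<open>x = h + w\<close> with \<open>h \<in> H\<close> and \<open>w\<close> in a
  prescribed small neighbourhood, and \<open>kh = kx - kw\<close>, by commutativity, stays in a fixed neighbourhood
  for \<open>k \<le> j\<close>, so that \<open>h\<close> is small because \<open>H\<close> is UFSS.\<close>

section \<open>Neighbourhoods of a point in arbitrary spaces and subspaces\<close>

lemma openin_imp_nbhd: "openin T V \<Longrightarrow> x \<in> V \<Longrightarrow> nbhd T x V"
  unfolding nbhd_def using openin_subset by blast

lemma nbhd_mono: "nbhd T x U \<Longrightarrow> U \<subseteq> V \<Longrightarrow> V \<subseteq> topspace T \<Longrightarrow> nbhd T x V"
  unfolding nbhd_def by blast

lemma nbhd_Int:
  assumes "nbhd T x U" "nbhd T x V"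
  shows "nbhd T x (U \<inter> V)"
proof -
  obtain A B where "openin T A" "x \<in> A" "A \<subseteq> U" "openin T B" "x \<in> B" "B \<subseteq> V"
    using assms unfolding nbhd_def by blast
  then have "openin T (A \<inter> B)" "x \<in> A \<inter> B" "A \<inter> B \<subseteq> U \<inter> V"
    by auto
  then show ?thesis
    using assms(1) unfolding nbhd_def by blast
qed

lemma nbhd_preimage:
  assumes "continuous_map S T f" "nbhd T (f x) U" "x \<in> topspace S"
  shows "nbhd S x {y \<in> topspace S. f y \<in> U}"
proof -
  obtain V where V: "openin T V" "f x \<in> V" "V \<subseteq> U"
    using assms(2) unfolding nbhd_def by blast
  have "openin S {y \<in> topspace S. f y \<in> V}"
    using assms(1) V(1) by (rule openin_continuous_map_preimage)
  then show ?thesis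
    unfolding nbhd_def using V assms(3) by blast
qed

lemma nbhd_subtopology:
  assumes "nbhd T x U" "x \<in> S"
  shows "nbhd (subtopology T S) x (U \<inter> S)"
proof -
  obtain V where "openin T V" "x \<in> V" "V \<subseteq> U" "U \<subseteq> topspace T"
    using assms(1) unfolding nbhd_def by blast
  then have "openin (subtopology T S) (V \<inter> S)" "x \<in> V \<inter> S" "V \<inter> S \<subseteq> U \<inter> S"
      "U \<inter> S \<subseteq> topspace (subtopology T S)"
    using assms(2) by (auto simp: openin_subtopology)
  then show ?thesis
    unfolding nbhd_def by blast
qed

lemma nbhd_subtopologyE:
  assumes "nbhd (subtopology T S) x U"
  obtains V where "openin T V" "x \<in> V" "V \<inter> S \<subseteq> U"
  using assms unfolding nbhd_def openin_subtopology by blast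

lemma frac_set_antimono:
  "m \<le> n \<Longrightarrow> U \<subseteq> V \<Longrightarrow> frac_set G n U \<subseteq> frac_set G m V"
  unfolding frac_set_def by force

section \<open>Neighbourhoods of the neutral element in a topological group\<close>

context topological_group
begin

lemma continuous_map_mult:
  assumes "continuous_map Z T f" "continuous_map Z T g"
  shows "continuous_map Z T (\<lambda>x. f x \<otimes> g x)"
  using continuous_map_compose[OF continuous_map_pairedI[OF assms] continuous_mult]
  by (simp add: o_def)

lemma continuous_map_inverse:
  assumes "continuous_map Z T f"
  shows "continuous_map Z T (\<lambda>x. inv f x)"
  using continuous_map_compose[OF assms continuous_inv] by (simp add: o_def)

lemma continuous_map_nat_pow: "continuous_map T T (\<lambda>x. x [^] (k::nat))"
proof (induction k)
  case 0
  then show ?case by (simp add: topspace_eq_carrier)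
next
  case (Suc k)
  then show ?case
    using continuous_map_mult[OF Suc.IH continuous_map_id[unfolded id_def]] by simp
qed

text \<open>Continuity at \<open>(\<one>, \<one>)\<close> yields a box, and intersecting its two
  sides gives one neighbourhood serving both arguments. Multiplication and division are the
  instances used.\<close>

lemma nbhd_binary:
  assumes "continuous_map (prod_topology T T) T f" "nbhd T (f (\<one>, \<one>)) W"
  obtains V where "nbhd T \<one> V" "\<And>x y. x \<in> V \<Longrightarrow> y \<in> V \<Longrightarrow> f (x, y) \<in> W"
proof -
  have "nbhd (prod_topology T T) (\<one>, \<one>) {z \<in> topspace (prod_topology T T). f z \<in> W}"
    using assms by (intro nbhd_preimage) (auto simp: topspace_eq_carrier)
  then obtain A B where AB: "openin T A" "openin T B" "\<one> \<in> A" "\<one> \<in> B" 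
      "A \<times> B \<subseteq> {z \<in> topspace (prod_topology T T). f z \<in> W}"
    unfolding nbhd_def openin_prod_topology_alt by (meson subset_trans)
  show ?thesis
    using AB by (intro that[of "A \<inter> B"] openin_imp_nbhd) auto
qed

lemma nbhd_mult:
  assumes "nbhd T \<one> W"
  obtains V where "nbhd T \<one> V" "\<And>x y. x \<in> V \<Longrightarrow> y \<in> V \<Longrightarrow> x \<otimes> y \<in> W"
  using nbhd_binary[OF continuous_mult] assms by auto

lemma continuous_map_divide: "continuous_map (prod_topology T T) T (\<lambda>z. fst z \<otimes> inv (snd z))"
  by (intro continuous_map_mult continuous_map_inverse continuous_map_fst continuous_map_snd)

lemma nbhd_divide:
  assumes "nbhd T \<one> W"
  obtains V where "nbhd T \<one> V" "\<And>x y. x \<in> V \<Longrightarrow> y \<in> V \<Longrightarrow> x \<otimes> inv y \<in> W"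
  using nbhd_binary[OF continuous_map_divide, of W] assms by auto

text \<open>Only finitely many power maps are involved, each continuous, so the set is a finite
  intersection of open preimages.\<close>

lemma openin_frac_set:
  assumes "openin T U"
  shows "openin T (frac_set G n U)"
proof -
  have "frac_set G n U = topspace T \<inter> \<Inter> ((\<lambda>k. {x \<in> topspace T. x [^] k \<in> U}) ` {1..n})"
    unfolding frac_set_def topspace_eq_carrier by auto
  moreover have "openin T {x \<in> topspace T. x [^] k \<in> U}" for k :: nat
    using continuous_map_nat_pow assms by (rule openin_continuous_map_preimage)
  \<comment> \<open>For \<open>n = 0\<close> the family of preimages is empty and the set is the
    whole carrier, so this case is separate.\<close>
  ultimately show ?thesis
    by (cases "n = 0") (auto intro!: openin_Int openin_Inter)
qed

lemma nbhd_frac_set: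
  assumes "nbhd T \<one> U"
  shows "nbhd T \<one> (frac_set G n U)"
proof -
  obtain V where V: "openin T V" "\<one> \<in> V" "V \<subseteq> U"
    using assms unfolding nbhd_def by blast
  have "\<one> \<in> frac_set G n V"
    using V(2) by (simp add: frac_set_def)
  then have "nbhd T \<one> (frac_set G n V)"
    using V(1) by (intro openin_imp_nbhd openin_frac_set)
  moreover have "frac_set G n U \<subseteq> topspace T"
    by (auto simp: frac_set_def topspace_eq_carrier)
  ultimately show ?thesis
    by (rule nbhd_mono[OF _ frac_set_antimono[OF order_refl V(3)]])
qed

text \<open>The diagonal is the preimage of \<open>{\<one>}\<close> under the continuous map sending
  \<open>(x, y)\<close> to \<open>x \<otimes> inv y\<close>.\<close>

lemma Hausdorff_space_if_closedin_one:
  assumes "closedin T {\<one>}"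
  shows "Hausdorff_space T"
proof -
  have "closedin (prod_topology T T)
      {z \<in> topspace (prod_topology T T). fst z \<otimes> inv (snd z) \<in> {\<one>}}"
    using continuous_map_divide assms by (rule closedin_continuous_map_preimage)
  moreover have "{z \<in> topspace (prod_topology T T). fst z \<otimes> inv (snd z) \<in> {\<one>}} =
      (\<lambda>x. (x, x)) ` topspace T"
    using inv_solve_right' by (force simp: topspace_eq_carrier)
  ultimately show ?thesis
    by (simp add: Hausdorff_space_closedin_diagonal)
qed

text \<open>Homogeneity reverses the roles of the two points: if \<open>V\<close> contains
  \<open>\<one>\<close> but not \<open>x\<close>, the points \<open>y\<close> with
  \<open>inv y \<otimes> x \<in> V\<close> form an open set containing \<open>x\<close> but not
  \<open>\<one>\<close>.\<close>

lemma closedin_one_if_separated: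
  assumes sep: "\<And>x. x \<in> carrier G \<Longrightarrow> x \<noteq> \<one> \<Longrightarrow> \<exists>V. nbhd T \<one> V \<and> x \<notin> V"
  shows "closedin T {\<one>}"
proof -
  have "\<exists>W. openin T W \<and> x \<in> W \<and> W \<subseteq> carrier G - {\<one>}" if x: "x \<in> carrier G - {\<one>}" for x
  proof -
    obtain V where V: "openin T V" "\<one> \<in> V" "x \<notin> V"
      using sep[of x] x unfolding nbhd_def by blast
    let ?W = "{y \<in> topspace T. inv y \<otimes> x \<in> V}"
    have "openin T ?W"
      using x by (intro openin_continuous_map_preimage[OF _ V(1)] continuous_map_mult
          continuous_inv) (simp add: topspace_eq_carrier)
    then show ?thesis
      using x V by (intro exI[of _ ?W]) (auto simp: topspace_eq_carrier)
  qed
  then have "openin T (carrier G - {\<one>})"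
    by (subst openin_subopen) blast
  then show ?thesis
    by (simp add: closedin_def topspace_eq_carrier)
qed

end

section \<open>A one-set criterion for UFSS\<close>

text \<open>The working form of the UFSS condition; \<open>UFSS_iff\<close> supplies the symmetry of
  \<open>U\<close> and the bound \<open>n \<ge> 1\<close>.\<close>

definition free_from_small_subgroups_on ::
  "('a, 'm) monoid_scheme \<Rightarrow> 'a topology \<Rightarrow> 'a set \<Rightarrow> bool" where
  "free_from_small_subgroups_on G T U \<longleftrightarrow> nbhd T \<one>\<^bsub>G\<^esub> U \<and>
     (\<forall>W. nbhd T \<one>\<^bsub>G\<^esub> W \<longrightarrow> (\<exists>n. frac_set G n U \<subseteq> W))"

lemma UFSS_iff:
  fixes G (structure)
  shows "UFSS G T \<longleftrightarrow>
     topological_group G T \<and> Hausdorff_space T \<and> (\<exists>U. free_from_small_subgroups_on G T U)"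
proof (cases "topological_group G T")
  case True
  then interpret topological_group G T .
  show ?thesis
  proof (intro iffI conjI; (elim conjE exE)?)
    fix U assume U: "free_from_small_subgroups_on G T U" and "Hausdorff_space T"
    \<comment> \<open>Intersecting \<open>U\<close> with its image under inversion makes it
      symmetric; the sets \<open>frac_set G n U\<close> can only shrink.\<close>
    let ?U = "U \<inter> {x \<in> topspace T. inv x \<in> U}"
    have nU: "nbhd T \<one> U" and sub: "U \<subseteq> carrier G"
      using U topspace_eq_carrier by (auto simp: free_from_small_subgroups_on_def nbhd_def)
    then have nbhd: "nbhd T \<one> ?U"
      by (intro nbhd_Int nbhd_preimage[OF continuous_inv]) (auto simp: topspace_eq_carrier)
    have sym: "symmetric_in G ?U"
      using sub by (auto simp: symmetric_in_def topspace_eq_carrier)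
    have small: "\<exists>n\<ge>1. frac_set G n ?U \<subseteq> W" if W: "nbhd T \<one> W" for W
    proof -
      obtain n where "frac_set G n U \<subseteq> W"
        using U W unfolding free_from_small_subgroups_on_def by blast
      \<comment> \<open>The given \<open>n\<close> may be \<open>0\<close>; the successor is a
        legitimate index and gives a smaller set.\<close>
      then have "frac_set G (Suc n) ?U \<subseteq> W"
        using frac_set_antimono[of n "Suc n" ?U U G] by auto
      then show ?thesis by (intro exI[of _ "Suc n"]) simp
    qed
    have "nbhd_basis T \<one> {frac_set G n ?U |n. n \<ge> 1}"
      unfolding nbhd_basis_def
    proof (intro conjI ballI allI impI)
      fix B assume "B \<in> {frac_set G n ?U |n. n \<ge> 1}"
      then show "nbhd T \<one> B"
        using nbhd_frac_set[OF nbhd] by auto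
    next
      fix W assume "nbhd T \<one> W"
      then obtain n where "n \<ge> 1" "frac_set G n ?U \<subseteq> W"
        using small by metis
      then show "\<exists>B\<in>{frac_set G n ?U |n. n \<ge> 1}. B \<subseteq> W"
        by (intro bexI[of _ "frac_set G n ?U"]) auto
    qed
    then show "UFSS G T"
      unfolding UFSS_def using True \<open>Hausdorff_space T\<close> nbhd sym by (intro conjI exI[of _ ?U])
  next
    assume "UFSS G T"
    then obtain U where U: "nbhd T \<one> U" "nbhd_basis T \<one> {frac_set G n U |n. n \<ge> 1}"
      unfolding UFSS_def by (elim conjE exE)
    have "\<exists>n. frac_set G n U \<subseteq> W" if W: "nbhd T \<one> W" for W
    proof -
      have "\<exists>B\<in>{frac_set G n U |n. n \<ge> 1}. B \<subseteq> W"
        using U(2) W by (simp only: nbhd_basis_def)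
      then show ?thesis by auto
    qed
    then have "free_from_small_subgroups_on G T U"
      unfolding free_from_small_subgroups_on_def using U(1) by simp
    then show "\<exists>U. free_from_small_subgroups_on G T U" ..
  next
    assume "UFSS G T"
    then show "Hausdorff_space T"
      by (simp add: UFSS_def)
  qed (rule True)
qed (simp add: UFSS_def)

lemma UFSS_I:
  assumes "topological_group G T" "Hausdorff_space T" "nbhd T \<one>\<^bsub>G\<^esub> U"
    and "\<And>W. nbhd T \<one>\<^bsub>G\<^esub> W \<Longrightarrow> \<exists>n. frac_set G n U \<subseteq> W"
  shows "UFSS G T"
proof -
  have "free_from_small_subgroups_on G T U"
    unfolding free_from_small_subgroups_on_def by (intro conjI allI impI assms(3,4))
  then show ?thesis
    unfolding UFSS_iff using assms(1,2) by (intro conjI exI[of _ U])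
qed

lemma UFSS_E:
  assumes "UFSS G T"
  obtains U where "topological_group G T" "Hausdorff_space T" "free_from_small_subgroups_on G T U"
  using assms unfolding UFSS_iff by blast

lemma free_from_small_subgroups_onD:
  assumes "free_from_small_subgroups_on G T U"
  shows "nbhd T \<one>\<^bsub>G\<^esub> U"
    and "nbhd T \<one>\<^bsub>G\<^esub> W \<Longrightarrow> \<exists>n. frac_set G n U \<subseteq> W"
  using assms unfolding free_from_small_subgroups_on_def by auto

section \<open>Dense embeddings and the completion\<close>

text \<open>An element of \<open>(1/n)V\<close> is approximated by elements of the dense subgroup
  that still lie in \<open>(1/n)V\<close>. These are small because \<open>G\<close> is UFSS, so the
  element is a small error times a small element.\<close>

lemma UFSS_dense:
  assumes G: "UFSS G T" and K: "topological_group K S" and "Hausdorff_space S"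
    and hom: "\<iota> \<in> hom G K" and emb: "embedding_map T S \<iota>"
    and dense: "S closure_of (\<iota> ` carrier G) = carrier K"
  shows "UFSS K S"
proof -
  obtain U where T: "topological_group G T" and "Hausdorff_space T"
    and free: "free_from_small_subgroups_on G T U"
    using UFSS_E[OF G] .
  note U = free_from_small_subgroups_onD(1)[OF free]
    and small = free_from_small_subgroups_onD(2)[OF free]
  interpret G: topological_group G T by fact
  interpret K: topological_group K S by fact
  have one: "\<iota> \<one>\<^bsub>G\<^esub> = \<one>\<^bsub>K\<^esub>"
    using hom_one[OF hom G.is_group K.is_group] .
  have pow: "\<iota> (x [^]\<^bsub>G\<^esub> (k::nat)) = \<iota> x [^]\<^bsub>K\<^esub> k" if "x \<in> carrier G" for x k
    using hom_nat_pow[OF hom that G.is_group K.is_group] .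
  obtain j where j: "homeomorphic_maps T (subtopology S (\<iota> ` topspace T)) \<iota> j"
    using emb unfolding embedding_map_def homeomorphic_map_maps by blast
  then have cont: "continuous_map T S \<iota>"
    and jcont: "continuous_map (subtopology S (\<iota> ` topspace T)) T j"
    and j\<iota>: "\<And>x. x \<in> carrier G \<Longrightarrow> j (\<iota> x) = x"
    by (auto simp: homeomorphic_maps_def continuous_map_in_subtopology G.topspace_eq_carrier)
  \<comment> \<open>Since \<open>j\<close> inverts \<open>\<iota>\<close> on its range, this set is
    the image of \<open>U\<close>, a neighbourhood in the embedded copy of \<open>G\<close>; the
    open set \<open>V\<close> obtained from it has its trace on that copy inside the image.\<close>
  have "nbhd (subtopology S (\<iota> ` topspace T)) \<one>\<^bsub>K\<^esub>
      {y \<in> topspace (subtopology S (\<iota> ` topspace T)). j y \<in> U}"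
    using j\<iota>[of "\<one>\<^bsub>G\<^esub>"] U one
    by (intro nbhd_preimage[OF jcont]) 
       (auto simp: G.topspace_eq_carrier K.topspace_eq_carrier intro: image_eqI[of _ _ "\<one>\<^bsub>G\<^esub>"])
  then obtain V where V: "openin S V" "\<one>\<^bsub>K\<^esub> \<in> V" 
      "V \<inter> \<iota> ` topspace T \<subseteq> {y \<in> topspace (subtopology S (\<iota> ` topspace T)). j y \<in> U}"
    by (rule nbhd_subtopologyE)
  have VU: "x \<in> U" if "x \<in> carrier G" "\<iota> x \<in> V" for x
    using V(3) that j\<iota> by (force simp: G.topspace_eq_carrier)
  have "\<exists>n. frac_set K n V \<subseteq> W" if W: "nbhd S \<one>\<^bsub>K\<^esub> W" for W
  proof -
    \<comment> \<open>One factor will be the approximation error, the other the approximating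
      element.\<close>
    obtain W0 where W0: "nbhd S \<one>\<^bsub>K\<^esub> W0" "\<And>x y. x \<in> W0 \<Longrightarrow> y \<in> W0 \<Longrightarrow> x \<otimes>\<^bsub>K\<^esub> y \<in> W"
      using K.nbhd_mult[OF W] by blast
    then obtain W1 where W1: "openin S W1" "\<one>\<^bsub>K\<^esub> \<in> W1" "W1 \<subseteq> W0"
      unfolding nbhd_def by blast
    have "nbhd T \<one>\<^bsub>G\<^esub> {x \<in> topspace T. \<iota> x \<in> W1}"
      using W1 one by (intro nbhd_preimage[OF cont] openin_imp_nbhd)
        (auto simp: G.topspace_eq_carrier)
    then obtain n where n: "frac_set G n U \<subseteq> {x \<in> topspace T. \<iota> x \<in> W1}"
      using small by blast
    have "x \<in> W" if x: "x \<in> frac_set K n V" for x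
    proof -
      have xK: "x \<in> carrier K" using x by (simp add: frac_set_def)
      \<comment> \<open>An open neighbourhood of \<open>x\<close> whose members \<open>y\<close> lie
        in \<open>(1/n)V\<close> and differ from \<open>x\<close> by an element of
        \<open>W1\<close>; openness lets density supply a member from \<open>G\<close>.\<close>
      let ?O = "frac_set K n V \<inter> {y \<in> topspace S. x \<otimes>\<^bsub>K\<^esub> inv\<^bsub>K\<^esub> y \<in> W1}"
      have "openin S ?O"
        using xK by (intro openin_Int K.openin_frac_set V(1) K.continuous_inv
            openin_continuous_map_preimage[OF _ W1(1)] K.continuous_map_mult)
          (simp add: K.topspace_eq_carrier)
      moreover have "x \<in> ?O"
        using x xK W1(2) by (simp add: K.topspace_eq_carrier)
      moreover have "x \<in> S closure_of (\<iota> ` carrier G)"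
        using dense xK by simp
      ultimately have "\<exists>y. y \<in> \<iota> ` carrier G \<and> y \<in> ?O"
        unfolding in_closure_of by (elim conjE allE[of _ ?O] impE conjI)
      then obtain g where g: "g \<in> carrier G" "\<iota> g \<in> ?O"
        by blast
      \<comment> \<open>The powers of \<open>\<iota> g\<close> are the images of the powers of
        \<open>g\<close>, and points of \<open>G\<close> mapped into \<open>V\<close> lie in
        \<open>U\<close>.\<close>
      then have "g \<in> frac_set G n U"
        using VU pow by (auto simp: frac_set_def)
      then have "\<iota> g \<in> W0" 
        using n W1(3) by blast
      then have "(x \<otimes>\<^bsub>K\<^esub> inv\<^bsub>K\<^esub> \<iota> g) \<otimes>\<^bsub>K\<^esub> \<iota> g \<in> W"
        using g(2) W1(3) W0(2) by blast
      moreover have "\<iota> g \<in> carrier K"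
        using g(1) hom by (auto simp: hom_def)
      ultimately show "x \<in> W"
        using xK by (simp add: K.m_assoc)
    qed
    then show ?thesis by blast
  qed
  then show ?thesis
    using K \<open>Hausdorff_space S\<close> openin_imp_nbhd[OF V(1,2)] by (intro UFSS_I)
qed

section \<open>Subgroups\<close>

lemma topological_group_subgroup:
  fixes G (structure)
  assumes "topological_group G T" "subgroup H G"
  shows "topological_group (G\<lparr>carrier := H\<rparr>) (subtopology T H)"
proof -
  interpret topological_group G T by fact
  interpret H: subgroup H G by fact
  interpret GH: group "G\<lparr>carrier := H\<rparr>"
    by (rule H.subgroup_is_group[OF is_group])
  have ts: "topspace (subtopology T H) = H"
    using H.subset by (auto simp: topspace_eq_carrier)
  show ?thesis
  proof unfold_locales
    show "continuous_map (prod_topology (subtopology T H) (subtopology T H)) (subtopology T H)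
        (\<lambda>(x, y). x \<otimes>\<^bsub>G\<lparr>carrier := H\<rparr>\<^esub> y)"
      using continuous_map_from_subtopology[OF continuous_mult, of "H \<times> H"] ts
      by (intro continuous_map_into_subtopology)
         (auto simp: subtopology_Times simp del: topspace_subtopology)
    have "continuous_map (subtopology T H) (subtopology T H) (\<lambda>x. inv x)"
      using continuous_map_from_subtopology[OF continuous_inv, of H] ts
      by (intro continuous_map_into_subtopology) (auto simp del: topspace_subtopology)
    then show "continuous_map (subtopology T H) (subtopology T H) 
        (\<lambda>x. inv\<^bsub>G\<lparr>carrier := H\<rparr>\<^esub> x)"
      by (rule continuous_map_eq) (metis ts m_inv_consistent[OF assms(2)])
  qed (use ts in simp)
qed

text \<open>Powers formed in \<open>H\<close> and in \<open>G\<close> agree, so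
  \<open>(1/n)(U \<inter> H)\<close> computed in \<open>H\<close> is inside
  \<open>(1/n)U\<close>.\<close>

lemma UFSS_subgroup:
  fixes G (structure)
  assumes G: "UFSS G T" and H: "subgroup H G"
  shows "UFSS (G\<lparr>carrier := H\<rparr>) (subtopology T H)"
proof -
  obtain U where T: "topological_group G T" and haus: "Hausdorff_space T"
    and free: "free_from_small_subgroups_on G T U"
    using UFSS_E[OF G] .
  note U = free_from_small_subgroups_onD(1)[OF free]
    and small = free_from_small_subgroups_onD(2)[OF free]
  interpret topological_group G T by fact
  interpret H: subgroup H G by fact
  have frac: "frac_set (G\<lparr>carrier := H\<rparr>) n (U \<inter> H) \<subseteq> frac_set G n U \<inter> H" for n
    using H.subset by (auto simp: frac_set_def nat_pow_consistent[symmetric])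
  show ?thesis
  proof (rule UFSS_I)
    show "nbhd (subtopology T H) \<one>\<^bsub>G\<lparr>carrier := H\<rparr>\<^esub> (U \<inter> H)"
      using U by (simp add: nbhd_subtopology)
    fix W assume "nbhd (subtopology T H) \<one>\<^bsub>G\<lparr>carrier := H\<rparr>\<^esub> W"
    then have "nbhd (subtopology T H) \<one> W"
      by simp
    then obtain V where V: "openin T V" "\<one> \<in> V" "V \<inter> H \<subseteq> W"
      by (rule nbhd_subtopologyE)
    obtain n where "frac_set G n U \<subseteq> V"
      using small[OF openin_imp_nbhd[OF V(1,2)]] ..
    then have "frac_set (G\<lparr>carrier := H\<rparr>) n (U \<inter> H) \<subseteq> W"
      using V(3) frac[of n] by fast
    then show "\<exists>n. frac_set (G\<lparr>carrier := H\<rparr>) n (U \<inter> H) \<subseteq> W" ..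
  qed (use topological_group_subgroup[OF T H] Hausdorff_space_subtopology[OF haus] in simp_all)
qed

section \<open>Finite products\<close>

lemma topological_group_product:
  assumes "\<And>i. i \<in> I \<Longrightarrow> topological_group (G i) (T i)"
  shows "topological_group (product_group I G) (product_topology T I)"
proof -
  have grp: "\<And>i. i \<in> I \<Longrightarrow> group (G i)"
    using assms by (simp add: topological_group_def)
  interpret group "product_group I G"
    by (rule product_group[OF grp])
  have ts: "\<And>i. i \<in> I \<Longrightarrow> topspace (T i) = carrier (G i)"
    using assms by (simp add: topological_group.topspace_eq_carrier)
  let ?P = "product_topology T I"
  have proj: "continuous_map ?P (T i) (\<lambda>x. x i)" if "i \<in> I" for i
    using that by (rule continuous_map_product_projection)
  have tsP: "topspace ?P = carrier (product_group I G)"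
    using ts by (auto simp: PiE_iff)
  show ?thesis
  proof unfold_locales
    show "topspace ?P = carrier (product_group I G)" by (rule tsP)
    have "continuous_map (prod_topology ?P ?P) (T i) (\<lambda>z. fst z i \<otimes>\<^bsub>G i\<^esub> snd z i)" if "i \<in> I" for i
      using continuous_map_compose[OF continuous_map_fst proj[OF that]]
        continuous_map_compose[OF continuous_map_snd proj[OF that]]
      by (intro topological_group.continuous_map_mult[OF assms[OF that]]) (simp_all add: o_def)
    then show "continuous_map (prod_topology ?P ?P) ?P (\<lambda>(x, y). x \<otimes>\<^bsub>product_group I G\<^esub> y)"
      by (auto simp: continuous_map_componentwise case_prod_beta )
    have "continuous_map ?P (T i) (\<lambda>x. inv\<^bsub>G i\<^esub> x i)" if "i \<in> I" for i
      using that by (intro topological_group.continuous_map_inverse[OF assms] proj)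
    then have "continuous_map ?P ?P (\<lambda>x. \<lambda>i\<in>I. inv\<^bsub>G i\<^esub> x i)"
      by (auto simp: continuous_map_componentwise )
    then show "continuous_map ?P ?P (\<lambda>x. inv\<^bsub>product_group I G\<^esub> x)"
      by (rule continuous_map_eq) (use tsP grp in \<open>simp add: inv_product_group\<close>)
  qed
qed

lemma nat_pow_product_group:
  assumes "\<And>i. i \<in> I \<Longrightarrow> group (G i)" "x \<in> carrier (product_group I G)" "i \<in> I"
  shows "(x [^]\<^bsub>product_group I G\<^esub> (k::nat)) i = x i [^]\<^bsub>G i\<^esub> k"
proof -
  have "(\<lambda>x. x i) \<in> hom (product_group I G) (G i)"
    using assms(3) by (auto simp: hom_def)
  then show ?thesis
    using hom_nat_pow[of "\<lambda>x. x i" "product_group I G" "G i" x k] assms product_group[of I G]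
    by blast
qed

lemma UFSS_product:
  assumes fin: "finite I" and G: "\<And>i. i \<in> I \<Longrightarrow> UFSS (G i) (T i)"
  shows "UFSS (product_group I G) (product_topology T I)"
proof -
  have T: "\<And>i. i \<in> I \<Longrightarrow> topological_group (G i) (T i)"
    and haus: "\<And>i. i \<in> I \<Longrightarrow> Hausdorff_space (T i)"
    using G by (auto simp: UFSS_def)
  have grp: "\<And>i. i \<in> I \<Longrightarrow> group (G i)"
    using T by (simp add: topological_group_def)
  \<comment> \<open>The witnesses are shrunk to open sets so that their box is open in the
    product.\<close>
  have "\<exists>U. openin (T i) U \<and> \<one>\<^bsub>G i\<^esub> \<in> U \<and>
      (\<forall>W. nbhd (T i) \<one>\<^bsub>G i\<^esub> W \<longrightarrow> (\<exists>n. frac_set (G i) n U \<subseteq> W))" if i: "i \<in> I" for i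
  proof -
    obtain U where free: "free_from_small_subgroups_on (G i) (T i) U"
      using UFSS_E[OF G[OF i]] by metis
    note U = free_from_small_subgroups_onD(1)[OF free]
    and small = free_from_small_subgroups_onD(2)[OF free]
    obtain V where V: "openin (T i) V" "\<one>\<^bsub>G i\<^esub> \<in> V" "V \<subseteq> U"
      using U unfolding nbhd_def by blast
    then show ?thesis
      using small frac_set_antimono[OF order_refl V(3), of "G i"] by (meson order.trans)
  qed
  then obtain U where U: "\<And>i. i \<in> I \<Longrightarrow> openin (T i) (U i)" "\<And>i. i \<in> I \<Longrightarrow> \<one>\<^bsub>G i\<^esub> \<in> U i"
    and small: "\<And>i W. i \<in> I \<Longrightarrow> nbhd (T i) \<one>\<^bsub>G i\<^esub> W \<Longrightarrow> \<exists>n. frac_set (G i) n (U i) \<subseteq> W"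
    by metis
  show ?thesis
  proof (rule UFSS_I)
    show "nbhd (product_topology T I) \<one>\<^bsub>product_group I G\<^esub> (Pi\<^sub>E I U)"
      using U fin by (intro openin_imp_nbhd) (auto simp: openin_PiE)
    show "Hausdorff_space (product_topology T I)"
      using haus by (simp add: Hausdorff_space_product_topology)
    fix W assume "nbhd (product_topology T I) \<one>\<^bsub>product_group I G\<^esub> W"
    then obtain V where V: "\<And>i. i \<in> I \<Longrightarrow> openin (T i) (V i)"
        "\<one>\<^bsub>product_group I G\<^esub> \<in> Pi\<^sub>E I V" "Pi\<^sub>E I V \<subseteq> W"
      unfolding nbhd_def openin_product_topology_alt by (meson order.trans)
    have "\<exists>n. frac_set (G i) n (U i) \<subseteq> V i" if "i \<in> I" for i
      using that V by (intro small openin_imp_nbhd) auto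
    then obtain n where n: "\<And>i. i \<in> I \<Longrightarrow> frac_set (G i) (n i) (U i) \<subseteq> V i"
      by metis
    \<comment> \<open>Each coordinate \<open>i\<close> needs its own index \<open>n i\<close>; as
      \<open>I\<close> is finite, the sum is a common upper bound.\<close>
    have "frac_set (product_group I G) (sum n I) (Pi\<^sub>E I U) \<subseteq> Pi\<^sub>E I V"
    proof
      fix x assume x: "x \<in> frac_set (product_group I G) (sum n I) (Pi\<^sub>E I U)"
      then have xc: "x \<in> carrier (product_group I G)"
        by (simp add: frac_set_def)
      have "x i \<in> frac_set (G i) (sum n I) (U i)" if "i \<in> I" for i
      proof -
        have "x i [^]\<^bsub>G i\<^esub> k \<in> U i" if "k \<in> {1..sum n I}" for k
        proof -
          have "x [^]\<^bsub>product_group I G\<^esub> k \<in> Pi\<^sub>E I U"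
            using x that unfolding frac_set_def by blast
          then show ?thesis
            using PiE_mem[OF _ \<open>i \<in> I\<close>] nat_pow_product_group[OF grp xc \<open>i \<in> I\<close>] by metis
        qed
        moreover have "x i \<in> carrier (G i)"
          using xc that by auto
        ultimately show ?thesis
          by (simp add: frac_set_def)
      qed
      moreover have "n i \<le> sum n I" if "i \<in> I" for i
        using that fin by (simp add: member_le_sum)
      ultimately have "x i \<in> V i" if "i \<in> I" for i
        using that n frac_set_antimono[of "n i" "sum n I" "U i" "U i" "G i"] by blast
      then show "x \<in> Pi\<^sub>E I V"
        using xc by auto
    qed
    then show "\<exists>n. frac_set (product_group I G) n (Pi\<^sub>E I U) \<subseteq> W"
      using V(3) by blast
  qed (use T in \<open>rule topological_group_product\<close>)
qed

section \<open>Local isomorphisms\<close>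

text \<open>Besides the smallness condition, the Hausdorff property of \<open>K\<close> has to be
  transferred: the local isomorphism gives it only on \<open>U\<close>, and homogeneity extends
  it.\<close>

lemma UFSS_locally_isomorphic:
  fixes K (structure)
  assumes G: "UFSS G T" and K: "topological_group K S" and iso: "locally_isomorphic K S G T"
  shows "UFSS K S"
proof -
  obtain U0 where T: "topological_group G T" and haus: "Hausdorff_space T"
    and free: "free_from_small_subgroups_on G T U0"
    using UFSS_E[OF G] .
  note U0 = free_from_small_subgroups_onD(1)[OF free]
    and small = free_from_small_subgroups_onD(2)[OF free]
  interpret G: topological_group G T by fact
  interpret K: topological_group K S by fact
  obtain U V f g where U: "nbhd S \<one> U" and V: "nbhd T \<one>\<^bsub>G\<^esub> V"
    and fg: "homeomorphic_maps (subtopology S U) (subtopology T V) f g"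
    and f_mult: "\<And>x y. x \<in> U \<Longrightarrow> y \<in> U \<Longrightarrow> x \<otimes> y \<in> U \<Longrightarrow> f (x \<otimes> y) = f x \<otimes>\<^bsub>G\<^esub> f y"
    using iso unfolding locally_isomorphic_def by blast
  have Usub: "U \<subseteq> carrier K" and oneU: "\<one> \<in> U" and Vsub: "V \<subseteq> carrier G" and oneV: "\<one>\<^bsub>G\<^esub> \<in> V"
    using U V by (auto simp: nbhd_def G.topspace_eq_carrier K.topspace_eq_carrier)
  then have tsU: "topspace (subtopology S U) = U" and tsV: "topspace (subtopology T V) = V"
    by (auto simp: G.topspace_eq_carrier K.topspace_eq_carrier)
  have contf: "continuous_map (subtopology S U) (subtopology T V) f"
    and contg: "continuous_map (subtopology T V) (subtopology S U) g"
    and gf: "\<And>x. x \<in> U \<Longrightarrow> g (f x) = x"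
    using fg tsU unfolding homeomorphic_maps_def by auto
  have fV: "f x \<in> V" if "x \<in> U" for x
    using contf that unfolding continuous_map_def tsU tsV by blast
  \<comment> \<open>Local additivity at \<open>(\<one>, \<one>)\<close> makes
    \<open>f \<one>\<close> idempotent, hence neutral.\<close>
  have f_one: "f \<one> = \<one>\<^bsub>G\<^esub>"
    using f_mult[OF oneU oneU] oneU fV[OF oneU] Vsub G.l_cancel_one'[of "f \<one>" "f \<one>"] by auto
  then have g_one: "g \<one>\<^bsub>G\<^esub> = \<one>"
    using gf[OF oneU] by simp
  \<comment> \<open>As \<open>U\<close> is itself a neighbourhood of \<open>\<one>\<close>,
    neighbourhoods in the subspace are neighbourhoods in the whole group; \<open>V\<close> is
    treated likewise.\<close>
  have nbhd_U: "nbhd S \<one> A" if A: "nbhd (subtopology S U) \<one> A" for A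
  proof (rule nbhd_subtopologyE[OF A])
    fix B assume "openin S B" "\<one> \<in> B" "B \<inter> U \<subseteq> A"
    moreover have "A \<subseteq> topspace S"
      using A unfolding nbhd_def by auto
    ultimately show ?thesis
      using nbhd_mono[OF nbhd_Int[OF openin_imp_nbhd U]] by blast
  qed
  have nbhd_V: "nbhd T \<one>\<^bsub>G\<^esub> A" if A: "nbhd (subtopology T V) \<one>\<^bsub>G\<^esub> A" for A
  proof (rule nbhd_subtopologyE[OF A])
    fix B assume "openin T B" "\<one>\<^bsub>G\<^esub> \<in> B" "B \<inter> V \<subseteq> A"
    moreover have "A \<subseteq> topspace T"
      using A unfolding nbhd_def by auto
    ultimately show ?thesis
      using nbhd_mono[OF nbhd_Int[OF openin_imp_nbhd V]] by blast
  qed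
  have preimage: "nbhd S \<one> {x \<in> U. f x \<in> A}" if "nbhd T \<one>\<^bsub>G\<^esub> A" for A
    using nbhd_preimage[OF contf, of \<one> "A \<inter> V"] nbhd_subtopology[OF that oneV] f_one fV oneU
    by (intro nbhd_U) (simp add: tsU fV del: topspace_subtopology cong: conj_cong)
  \<comment> \<open>The induction needs every intermediate power in \<open>U\<close>, since
    \<open>f\<close> is multiplicative only on products that stay there.\<close>
  have pow: "f (x [^] k) = f x [^]\<^bsub>G\<^esub> k"
    if x: "x \<in> U" and k: "\<And>j. j \<in> {1..k} \<Longrightarrow> x [^] j \<in> U" for x and k :: nat
    using k
  proof (induction k)
    case 0
    then show ?case using f_one by simp
  next
    case (Suc k)
    have "x [^] k \<in> U"
      using Suc.prems[of k] oneU by (cases "k = 0") auto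
    moreover have "x [^] k \<otimes> x \<in> U"
      using Suc.prems[of "Suc k"] by simp
    ultimately show ?case
      using Suc x f_mult by simp
  qed
  let ?P = "{x \<in> U. f x \<in> U0}"
  \<comment> \<open>The index \<open>Suc n\<close> guarantees that \<open>k = 1\<close> is tested,
    so \<open>x \<in> U\<close> even when \<open>n = 0\<close>.\<close>
  have P: "frac_set K (Suc n) ?P \<subseteq> {x \<in> U. f x \<in> frac_set G n U0}" for n
  proof
    fix x assume x: "x \<in> frac_set K (Suc n) ?P"
    then have xP: "x [^] k \<in> ?P" if "k \<in> {1..Suc n}" for k
      using that by (simp add: frac_set_def)
    have xU: "x \<in> U"
      using xP[of 1] x by (simp add: frac_set_def)
    have "f x [^]\<^bsub>G\<^esub> k \<in> U0" if "k \<in> {1..n}" for k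
      using pow[OF xU, of k] xP that by fastforce
    then show "x \<in> {x \<in> U. f x \<in> frac_set G n U0}"
      using xU fV Vsub by (auto simp: frac_set_def)
  qed
  have "Hausdorff_space (subtopology S U)"
    using fg haus homeomorphic_Hausdorff_space homeomorphic_space_def Hausdorff_space_subtopology
    by blast
  \<comment> \<open>A point outside \<open>U\<close> is separated from \<open>\<one>\<close> by
    \<open>U\<close> itself, a point inside by the Hausdorff property of \<open>U\<close>.\<close>
  have "\<exists>W. nbhd S \<one> W \<and> x \<notin> W" if x: "x \<noteq> \<one>" for x
  proof (cases "x \<in> U")
    case True
    then obtain A where "openin (subtopology S U) A" "\<one> \<in> A" "x \<notin> A"
      using \<open>Hausdorff_space (subtopology S U)\<close> x oneU tsU
      unfolding Hausdorff_space_def disjnt_iff by metis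
    then show ?thesis
      using nbhd_U[OF openin_imp_nbhd] by blast
  qed (use U in blast)
  then have "Hausdorff_space S"
    by (intro K.Hausdorff_space_if_closedin_one K.closedin_one_if_separated)
  moreover have "\<exists>n. frac_set K n ?P \<subseteq> W" if W: "nbhd S \<one> W" for W
  proof -
    \<comment> \<open>The target \<open>W\<close> is carried to \<open>G\<close> through the inverse
      \<open>g\<close>, so smallness in \<open>G\<close> can be applied and pulled back by
      \<open>gf\<close>.\<close>
    have "nbhd T \<one>\<^bsub>G\<^esub> {y \<in> V. g y \<in> W \<inter> U}"
      using nbhd_preimage[OF contg, of "\<one>\<^bsub>G\<^esub>" "W \<inter> U"] nbhd_subtopology[OF W oneU] g_one oneV
      by (intro nbhd_V) (simp add: tsV del: topspace_subtopology)
    then obtain n where "frac_set G n U0 \<subseteq> {y \<in> V. g y \<in> W \<inter> U}"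
      using small by blast
    then show ?thesis
      using P[of n] gf by fastforce
  qed
  ultimately show ?thesis
    using K preimage[OF U0] by (intro UFSS_I)
qed

section \<open>Extensions of UFSS groups\<close>

text \<open>The canonical projection is open: the set of points whose coset meets an open
  \<open>V\<close> is a union of translates of \<open>V\<close> by elements of \<open>H\<close>. The
  point \<open>H\<close> is the neutral element of the quotient.\<close>

lemma (in topological_group) nbhd_quotient_image:
  assumes H: "H \<lhd> G" and W: "nbhd T \<one> W"
  shows "nbhd (quotient_group_topology G T H) H ((\<lambda>x. H #> x) ` W)"
proof -
  interpret normal H G by fact
  obtain V where V: "openin T V" "\<one> \<in> V" "V \<subseteq> W" "W \<subseteq> carrier G"
    using W topspace_eq_carrier unfolding nbhd_def by auto
  let ?Q = "(\<lambda>x. H #> x) ` V"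
  have "{x \<in> topspace T. H #> x \<in> ?Q} = (\<Union>h\<in>H. {x \<in> topspace T. h \<otimes> x \<in> V})"
  proof (intro subset_antisym subsetI)
    fix x assume "x \<in> {x \<in> topspace T. H #> x \<in> ?Q}"
    then obtain v where v: "x \<in> carrier G" "v \<in> V" "H #> x = H #> v"
      by (auto simp: topspace_eq_carrier)
    then have "v \<in> H #> x"
      using V rcos_self[OF _ is_subgroup, of v] by auto
    then show "x \<in> (\<Union>h\<in>H. {x \<in> topspace T. h \<otimes> x \<in> V})"
      using v by (auto simp: r_coset_def topspace_eq_carrier)
  next
    fix x assume "x \<in> (\<Union>h\<in>H. {x \<in> topspace T. h \<otimes> x \<in> V})"
    then obtain h where h: "h \<in> H" "x \<in> carrier G" "h \<otimes> x \<in> V"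
      by (auto simp: topspace_eq_carrier)
    then have "H #> x = H #> (h \<otimes> x)"
      by (intro repr_independence[OF _ _ is_subgroup]) (auto simp: r_coset_def)
    then show "x \<in> {x \<in> topspace T. H #> x \<in> ?Q}"
      using h by (auto simp: topspace_eq_carrier)
  qed
  moreover have "openin T {x \<in> topspace T. h \<otimes> x \<in> V}" if "h \<in> H" for h
    using that mem_carrier
    by (intro openin_continuous_map_preimage[OF _ V(1)] continuous_map_mult)
      (auto simp: topspace_eq_carrier)
  ultimately have "openin (quotient_group_topology G T H) ?Q"
    using V by (auto simp: openin_quotient_group_topology RCOSETS_def)
  then have "nbhd (quotient_group_topology G T H) (H #> \<one>) ?Q"
    using V(2) by (intro openin_imp_nbhd) auto
  moreover have "(\<lambda>x. H #> x) ` W \<subseteq> topspace (quotient_group_topology G T H)"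
    using quotient_imp_surjective_map[OF quotient_map_quotient_group_topology, of T G H] V(4)
      topspace_eq_carrier by blast
  ultimately show ?thesis
    using V(3) nbhd_mono[of _ _ ?Q "(\<lambda>x. H #> x) ` W"] coset_mult_one[OF subset]
    by (simp add: image_mono)
qed

lemma UFSS_extension:
  fixes G (structure)
  assumes comm: "comm_group G" and T: "topological_group G T" and H: "subgroup H G"
    and closed: "closedin T H"
    and UFSS_H: "UFSS (G\<lparr>carrier := H\<rparr>) (subtopology T H)"
    and UFSS_quot: "UFSS (G Mod H) (quotient_group_topology G T H)"
  shows "UFSS G T"
proof -
  interpret comm_group G by fact
  interpret topological_group G T by fact
  interpret normal H G
    using comm H by (rule comm_group.subgroup_imp_normal)
  let ?Q = "quotient_group_topology G T H"
  obtain UH where haus: "Hausdorff_space (subtopology T H)"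
    and free_H: "free_from_small_subgroups_on (G\<lparr>carrier := H\<rparr>) (subtopology T H) UH"
    using UFSS_E[OF UFSS_H] by metis
  obtain UQ where free_quot: "free_from_small_subgroups_on (G Mod H) ?Q UQ"
    using UFSS_E[OF UFSS_quot] by metis
  note UH = free_from_small_subgroups_onD(1)[OF free_H, simplified]
    and small_H = free_from_small_subgroups_onD(2)[OF free_H, simplified]
  note UQ = free_from_small_subgroups_onD(1)[OF free_quot, simplified]
    and small_quot = free_from_small_subgroups_onD(2)[OF free_quot, simplified]
  have coset_one: "H #> \<one> = H"
    using coset_mult_one[OF subset] .
  have cont: "continuous_map T ?Q (\<lambda>x. H #> x)"
    using quotient_imp_continuous_map quotient_map_quotient_group_topology topspace_eq_carrier
    by blast
  obtain U1 where U1: "openin T U1" "\<one> \<in> U1" "U1 \<inter> H \<subseteq> UH"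
    using UH by (rule nbhd_subtopologyE)
  obtain U2 where U2: "nbhd T \<one> U2" "\<And>x y. x \<in> U2 \<Longrightarrow> y \<in> U2 \<Longrightarrow> x \<otimes> inv y \<in> U1"
    using nbhd_divide[OF openin_imp_nbhd[OF U1(1,2)]] by blast
  \<comment> \<open>The first part controls the powers of \<open>x\<close> in \<open>G\<close>, the
    second the powers of its coset.\<close>
  let ?U = "U2 \<inter> {x \<in> topspace T. H #> x \<in> UQ}"
  show ?thesis
  proof (rule UFSS_I)
    \<comment> \<open>The neutral element is closed in \<open>H\<close> and \<open>H\<close> is
      closed in \<open>G\<close>, hence it is closed in \<open>G\<close>.\<close>
    have "closedin (subtopology T H) {\<one>}"
      using haus by (intro closedin_Hausdorff_singleton) (auto simp: topspace_eq_carrier)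
    then show "Hausdorff_space T"
      using closed by (intro Hausdorff_space_if_closedin_one) (rule closedin_trans_full)
    show "nbhd T \<one> ?U"
      using U2(1) UQ by (intro nbhd_Int nbhd_preimage[OF cont])
        (auto simp: coset_one topspace_eq_carrier)
    fix W assume "nbhd T \<one> W"
    then obtain W1 where W1: "nbhd T \<one> W1" "\<And>x y. x \<in> W1 \<Longrightarrow> y \<in> W1 \<Longrightarrow> x \<otimes> y \<in> W"
      using nbhd_mult by blast
    \<comment> \<open>This \<open>j\<close> is the number of powers of the
      \<open>H\<close>-component that must stay in \<open>UH\<close>.\<close>
    obtain j where j: "frac_set (G\<lparr>carrier := H\<rparr>) j UH \<subseteq> W1 \<inter> H"
      using small_H[OF nbhd_subtopology[OF W1(1)]] by auto
    \<comment> \<open>The representative \<open>w\<close> must be small itself and have its first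
      \<open>j\<close> powers in \<open>U2\<close>, to be divided out of those of
      \<open>x\<close>.\<close>
    let ?W2 = "W1 \<inter> frac_set G j U2"
    have "nbhd T \<one> ?W2"
      using W1(1) U2(1) by (intro nbhd_Int nbhd_frac_set)
    then obtain m where m: "frac_set (G Mod H) m UQ \<subseteq> (\<lambda>x. H #> x) ` ?W2"
      using small_quot[OF nbhd_quotient_image[OF normal_axioms]] by blast
    \<comment> \<open>The first \<open>m\<close> powers of \<open>x\<close> locate its coset, the
      first \<open>j\<close> bound the powers of the \<open>H\<close>-component.\<close>
    have "x \<in> W" if x: "x \<in> frac_set G (max j m) ?U" for x
    proof -
      have xG: "x \<in> carrier G" and xU: "\<And>k. k \<in> {1..max j m} \<Longrightarrow> x [^] k \<in> ?U"
        using x by (auto simp: frac_set_def)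
      have "H #> x \<in> frac_set (G Mod H) m UQ"
        using xG xU by (auto simp: frac_set_def FactGroup_pow carrier_FactGroup)
      then obtain w where w: "w \<in> ?W2" "H #> x = H #> w"
        using m by blast
      then have wG: "w \<in> carrier G"
        by (simp add: frac_set_def)
      have "x \<in> H #> w"
        using w(2) rcos_self[OF xG H] by simp
      then obtain h where h: "h \<in> H" "x = h \<otimes> w"
        by (auto simp: r_coset_def)
      have hG: "h \<in> carrier G"
        using h(1) by (rule mem_carrier)
      have "h [^] k \<in> UH" if k: "k \<in> {1..j}" for k
      proof -
        have "x [^] k \<in> U2" "w [^] k \<in> U2"
          using xU[of k] w(1) k by (auto simp: frac_set_def)
        then have "x [^] k \<otimes> inv (w [^] k) \<in> U1"
          by (rule U2(2))
        \<comment> \<open>Commutativity enters here: the power of \<open>h \<otimes> w\<close>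
          splits into the powers of its factors.\<close>
        moreover have "x [^] k \<otimes> inv (w [^] k) = h [^] k"
          using hG wG by (simp add: h(2) pow_mult_distrib[OF m_comm] m_assoc)
        moreover have "h [^] k \<in> H"
          using monoid.nat_pow_closed[OF group.is_monoid[OF subgroup_is_group[OF is_group]], of h k]
            h(1) by (simp add: nat_pow_consistent[symmetric])
        ultimately show ?thesis
          using U1(3) by auto
      qed
      then have "h \<in> frac_set (G\<lparr>carrier := H\<rparr>) j UH"
        using h(1) by (simp add: frac_set_def nat_pow_consistent[symmetric])
      then show ?thesis
        using j w(1) W1(2) h(2) by blast
    qed
    then show "\<exists>n. frac_set G n ?U \<subseteq> W" by blast
  qed (rule T)
qed

section \<open>The five permanence properties together\<close>

theorem proposition3p12:
  shows
    "(\<forall>(G :: 'a monoid) T (K :: 'b monoid) S \<iota>.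
        UFSS G T \<and> raikov_completion G T K S \<iota> \<longrightarrow> UFSS K S)
   \<and> (\<forall>(G :: 'c monoid) T H.
        UFSS G T \<and> subgroup H G \<longrightarrow> UFSS (G\<lparr>carrier := H\<rparr>) (subtopology T H))
   \<and> (\<forall>(I :: 'i set) (G :: 'i \<Rightarrow> 'd monoid) T.
        finite I \<and> (\<forall>i\<in>I. UFSS (G i) (T i)) \<longrightarrow> UFSS (product_group I G) (product_topology T I))
   \<and> (\<forall>(G :: 'e monoid) T (K :: 'f monoid) S.
        UFSS G T \<and> topological_group K S \<and> locally_isomorphic K S G T \<longrightarrow> UFSS K S)
   \<and> (\<forall>(G :: 'g monoid) T H.
        comm_group G \<and> topological_group G T \<and> subgroup H G \<and> closedin T H \<and>
        UFSS (G\<lparr>carrier := H\<rparr>) (subtopology T H) \<and>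
        UFSS (G Mod H) (quotient_group_topology G T H) \<longrightarrow> UFSS G T)"
proof (intro conjI allI impI; elim conjE)
  fix G :: "'a monoid" and T and K :: "'b monoid" and S \<iota>
  assume "UFSS G T" "raikov_completion G T K S \<iota>"
  then show "UFSS K S"
    unfolding raikov_completion_def by (elim conjE) (rule UFSS_dense)
next
  fix G :: "'c monoid" and T H
  assume "UFSS G T" "subgroup H G"
  then show "UFSS (G\<lparr>carrier := H\<rparr>) (subtopology T H)"
    by (rule UFSS_subgroup)
next
  fix I :: "'i set" and G :: "'i \<Rightarrow> 'd monoid" and T
  assume "finite I" "\<forall>i\<in>I. UFSS (G i) (T i)"
  then show "UFSS (product_group I G) (product_topology T I)"
    by (intro UFSS_product) auto
next
  fix G :: "'e monoid" and T and K :: "'f monoid" and S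
  assume "UFSS G T" "topological_group K S" "locally_isomorphic K S G T"
  then show "UFSS K S"
    by (rule UFSS_locally_isomorphic)
next
  fix G :: "'g monoid" and T H
  assume "comm_group G" "topological_group G T" "subgroup H G" "closedin T H"
    "UFSS (G\<lparr>carrier := H\<rparr>) (subtopology T H)"
    "UFSS (G Mod H) (quotient_group_topology G T H)"
  then show "UFSS G T"
    by (rule UFSS_extension)
qed

end
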